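(* Let $x\in\mathbb{R}^{nr}$, $y\in\mathbb{R}^{t(n)}$, $\Lambda=\operatorname{sMat}(\lambda)\in\mathcal{S}^n$, and $\lambda_u=\operatorname{svec}(\Lambda_u)$, $\lambda_l=\operatorname{svec}(\Lambda_l)$ with $\Lambda_u,\Lambda_l\in\mathcal{S}^{m+n}$. Consider the problem $$(SNL_{MN})\qquad \begin{array}{rl}\min_{x,y} & f_3(x,y):=\frac12\|W\circ\mathcal{K}(\mathcal{Y}(x,y))-\bar E\|_F^2\\ \text{subject to} & H_u\circ\mathcal{K}(\mathcal{Y}(x,y))-\bar U\le 0,\\ & \bar L-H_l\circ\mathcal{K}(\mathcal{Y}(x,y))\le 0,\\ & \frac12\operatorname{Mat}(x)\operatorname{Mat}(x)^T-\operatorname{sMat}(y)\preceq 0,\end{array}$$ and put $$s_u=\operatorname{svec}\big(\bar U-H_u\circ\mathcal{K}(\mathcal{Y}(x,y))\big),\quad s_l=\operatorname{svec}\big(H_l\circ\mathcal{K}(\mathcal{Y}(x,y))-\bar L\big),\quad Z=\operatorname{sMat}(y)-\tfrac12\operatorname{Mat}(x)\operatorname{Mat}(x)^T.$$ The primal-dual variables $x,y,\Lambda,\lambda_u,\lambda_l$ are optimal for $(SNL_{MN})$ if and only if the following three conditions hold. 1. Primal feasibility: $s_u\ge 0$, $s_l\ge 0$, and $\frac12\operatorname{Mat}(x)\operatorname{Mat}(x)^T-\operatorname{sMat}(y)\preceq 0$. 2. Dual feasibility: the stationarity equations $$(\mathcal{K}^x_W)^*\big(W\circ\mathcal{K}(\mathcal{Y}(x,y))-\bar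 E\big)+(\mathcal{K}^x_{H_u})^*(\Lambda_u)-(\mathcal{K}^x_{H_l})^*(\Lambda_l)+\operatorname{vec}(\Lambda\operatorname{Mat}(x))=0,$$ $$(\mathcal{K}^y_W)^*\big(W\circ\mathcal{K}(\mathcal{Y}(x,y))-\bar E\big)+(\mathcal{K}^y_{H_u})^*(\Lambda_u)-(\mathcal{K}^y_{H_l})^*(\Lambda_l)-\operatorname{svec}(\Lambda)=0$$ hold, and $\Lambda\succeq 0$, $\lambda_u\ge 0$, $\lambda_l\ge 0$. 3. Complementary slackness: $\lambda_u\circ s_u=0$, $\lambda_l\circ s_l=0$, $\Lambda Z=0$.
   Context: Notation. $\mathcal{S}^k$ is the space of real symmetric $k\times k$ matrices with the trace inner product, $\succeq$ the Löwner order, $\circ$ the Hadamard (entrywise) product, $\|\cdot\|_F$ the Frobenius norm, $e$ the vector of ones, and $t(k)=k(k+1)/2$. Inequalities $\le,\ge$ between matrices or vectors are entrywise. $\operatorname{svec}:\mathcal{S}^k\to\mathbb{R}^{t(k)}$ is the isometry that stacks the upper triangular part with off-diagonal entries multiplied by $\sqrt2$, and $\operatorname{sMat}$ is its inverse. $\operatorname{vec}:\mathbb{R}^{n\times r}\to\mathbb{R}^{nr}$ stacks columns, and $\operatorname{Mat}$ is its inverse. The superscript ${}^*$ denotes the adjoint with respect to the standard (trace) inner products. The operator $\mathcal{K}$ is $\mathcal{K}(B)=\operatorname{diag}(B)e^T+e\operatorname{diag}(B)^T-2B$, where $\operatorname{diag}(B)$ is the vector of diagonal entries. Data. There are $n$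 sensors (unknown points) and $m$ anchors (known points) in $\mathbb{R}^r$. The rows of $A\in\mathbb{R}^{m\times r}$ are the anchors. Standing assumption: $n\gg m>r$, $A^Te=0$, and $A$ has full column rank. $E\in\mathcal{S}^{n+m}$ is the partial matrix of given squared distances (zero where unspecified). $W\in\mathcal{S}^{n+m}$ is a weight matrix with positive entries where the distance is specified (including all anchor–anchor pairs) and zeros otherwise. $U^b,L^b\in\mathcal{S}^{n+m}$ are matrices of squared upper and lower distance bounds. $H_u,H_l\in\mathcal{S}^{n+m}$ are $0$–$1$ matrices with entry $1$ exactly where an upper (respectively lower) bound exists. Variables and operators. The variables are $x=\sqrt2\operatorname{vec}(X)$ with $X\in\mathbb{R}^{n\times r}$ and $y=\operatorname{svec}(Y)$ with $Y\in\mathcal{S}^n$. Define $$\mathcal{Y}^x(x)=\frac1{\sqrt2}\begin{pmatrix}0&\operatorname{Mat}(x)A^T\\ A\operatorname{Mat}(x)^T&0\end{pmatrix},\quad \mathcal{Y}^y(y)=\begin{pmatrix}\operatorname{sMat}(y)&0\\0&0\end{pmatrix},\quad \mathcal{Y}(x,y)=\mathcal{Y}^x(x)+\mathcal{Y}^y(y)\in\mathcal{S}^{n+m}.$$ With $C=\begin{pmatrix}0&0\\0&AA^T\end{pmatrix}\in\mathcal{S}^{n+m}$, set $\bar E=W\circ[E-\mathcal{K}(C)]$, $\bar U=H_u\circ[U^b-\mathcal{K}(C)]$, $\bar L=H_l\circ[L^b-\mathcal{K}(C)]$. For $H\in\mathcal{S}^{n+m}$, let $\mathcal{K}^x_H(x)=H\circ\mathcal{K}(\mathcal{Y}^x(x))$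 and $\mathcal{K}^y_H(y)=H\circ\mathcal{K}(\mathcal{Y}^y(y))$. Lagrangian and dual. The Lagrangian is $$L(x,y,\Lambda_u,\Lambda_l,\Lambda)=f_3(x,y)+\langle\Lambda_u,H_u\circ\mathcal{K}(\mathcal{Y}(x,y))-\bar U\rangle+\langle\Lambda_l,\bar L-H_l\circ\mathcal{K}(\mathcal{Y}(x,y))\rangle+\langle\Lambda,\tfrac12\operatorname{Mat}(x)\operatorname{Mat}(x)^T-\operatorname{sMat}(y)\rangle.$$ The (Wolfe) dual problem maximizes $L$ over $(x,y,\Lambda_u,\Lambda_l,\Lambda)$ subject to $\nabla_xL=0$, $\nabla_yL=0$, $\Lambda_u\ge 0$, $\Lambda_l\ge 0$, $\Lambda\succeq 0$. The primal-dual variables are called optimal when $(x,y)$ solves $(SNL_{MN})$ and $(x,y,\Lambda_u,\Lambda_l,\Lambda)$ solves this dual. *)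

theory Defs
  imports "HOL-Analysis.Analysis"
begin

(* Rows and columns of matrices in S^(n+m) are indexed by the disjoint sum 'n + 'm: sensors (Inl)
   come before anchors (Inr).  The linear order only serves to single out an upper triangle. *)

instantiation sum :: (linorder, linorder) linorder
begin

fun less_eq_sum :: "'a + 'b \<Rightarrow> 'a + 'b \<Rightarrow> bool" where
  "less_eq_sum (Inl a) (Inl b) \<longleftrightarrow> a \<le> b"
| "less_eq_sum (Inl a) (Inr b) \<longleftrightarrow> True"
| "less_eq_sum (Inr a) (Inl b) \<longleftrightarrow> False"
| "less_eq_sum (Inr a) (Inr b) \<longleftrightarrow> a \<le> b"

definition less_sum :: "'a + 'b \<Rightarrow> 'a + 'b \<Rightarrow> bool" where
  "less_sum s t \<longleftrightarrow> s \<le> t \<and> \<not> t \<le> s"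

instance
proof
  fix x y z :: "'a + 'b"
  show "x < y \<longleftrightarrow> x \<le> y \<and> \<not> y \<le> x" by (rule less_sum_def)
  show "x \<le> x" by (cases x) auto
  show "x \<le> y \<Longrightarrow> y \<le> z \<Longrightarrow> x \<le> z" by (cases x; cases y; cases z) auto
  show "x \<le> y \<Longrightarrow> y \<le> x \<Longrightarrow> x = y" by (cases x; cases y) auto
  show "x \<le> y \<or> y \<le> x" by (cases x; cases y) auto
qed

end

(* If 'a has k elements then 'a upper has t(k) = k(k+1)/2 elements (card_upper below), so that
   real ^ ('a upper) is R^t(k). *)

typedef (overloaded) 'a upper = "{p :: 'a::linorder \<times> 'a. fst p \<le> snd p}"
proof -
  have "(undefined :: 'a, undefined :: 'a) \<in> {p. fst p \<le> snd p}" by simp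
  then show ?thesis by blast
qed

lemma UNIV_upper: "(UNIV :: 'a::linorder upper set) = Abs_upper ` {p. fst p \<le> snd p}"
  by (rule type_definition.Abs_image[OF type_definition_upper, symmetric])

instance upper :: ("{finite, linorder}") finite
proof
  show "finite (UNIV :: 'a upper set)" unfolding UNIV_upper by (rule finite_imageI) simp
qed

section \<open>Matrices\<close>

definition sym_mat :: "real ^ 'k ^ 'k \<Rightarrow> bool" where
  "sym_mat B \<longleftrightarrow> transpose B = B"

definition psd :: "real ^ 'k ^ 'k \<Rightarrow> bool" where
  "psd B \<longleftrightarrow> sym_mat B \<and> (\<forall>v. 0 \<le> v \<bullet> (B *v v))"

definition loewner_le :: "real ^ 'k ^ 'k \<Rightarrow> real ^ 'k ^ 'k \<Rightarrow> bool" (infix "\<preceq>" 50) where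
  "B \<preceq> D \<longleftrightarrow> psd (D - B)"

(* On the type of vectors (hence on matrices, too) the library operations * and \<le> are entrywise,
   the inner product is the trace inner product, and the norm is the Frobenius norm.
   The matrix product is **. *)

abbreviation hadamard :: "'a::times \<Rightarrow> 'a \<Rightarrow> 'a" (infixl "\<odot>" 70) where
  "B \<odot> D \<equiv> B * D"

definition svec :: "real ^ ('k::{finite,linorder}) ^ ('k::{finite,linorder}) \<Rightarrow> real ^ 'k upper" where
  "svec B = (\<chi> p. case Rep_upper p of (i, j) \<Rightarrow> if i = j then B $ i $ j else sqrt 2 * B $ i $ j)"

definition sMat :: "real ^ 'k upper \<Rightarrow> real ^ ('k::{finite,linorder}) ^ ('k::{finite,linorder})" where
  "sMat b = (\<chi> i j. if i = j then b $ Abs_upper (i, j)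
                    else (1 / sqrt 2) * b $ Abs_upper (min i j, max i j))"

(* The component (j, i) of a vector in R^(nr) is the i-th entry of the j-th column. *)

definition mvec :: "real ^ 'r ^ 'n \<Rightarrow> real ^ ('r \<times> 'n)" where
  "mvec X = (\<chi> p. X $ snd p $ fst p)"

definition Mat :: "real ^ ('r \<times> 'n) \<Rightarrow> real ^ 'r ^ 'n" where
  "Mat x = (\<chi> i j. x $ (j, i))"

definition blockmat :: "real ^ 'n ^ 'n \<Rightarrow> real ^ 'm ^ 'n \<Rightarrow> real ^ 'n ^ 'm \<Rightarrow> real ^ 'm ^ 'm
    \<Rightarrow> real ^ ('n + 'm) ^ ('n + 'm)" where
  "blockmat P Q R S = (\<chi> i j.
     case i of Inl a \<Rightarrow> (case j of Inl b \<Rightarrow> P $ a $ b | Inr b \<Rightarrow> Q $ a $ b)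
             | Inr a \<Rightarrow> (case j of Inl b \<Rightarrow> R $ a $ b | Inr b \<Rightarrow> S $ a $ b))"

lemma mvec_Mat [simp]: "mvec (Mat x) = x"
  by (simp add: mvec_def Mat_def vec_eq_iff)

lemma Mat_mvec [simp]: "Mat (mvec X) = X"
  by (simp add: mvec_def Mat_def vec_eq_iff)

lemma svec_sMat [simp]: "svec (sMat b) = b"
proof -
  have "svec (sMat b) $ p = b $ p" for p
  proof (cases "Rep_upper p")
    case (Pair i j)
    then have "i \<le> j" and p: "Abs_upper (i, j) = p"
      using Rep_upper[of p] Rep_upper_inverse[of p] by auto
    then show ?thesis
      by (auto simp: svec_def sMat_def Pair min_absorb1 max_absorb2)
  qed
  then show ?thesis by (simp add: vec_eq_iff)
qed

lemma sym_mat_sMat [simp]: "sym_mat (sMat b)"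
  by (simp add: sym_mat_def sMat_def transpose_def vec_eq_iff min.commute max.commute)

lemma sMat_svec:
  assumes "sym_mat B" shows "sMat (svec B) = B"
proof -
  have s: "B $ i $ j = B $ j $ i" for i j
    using assms by (simp add: sym_mat_def transpose_def vec_eq_iff)
  have "sMat (svec B) $ i $ j = B $ i $ j" for i j
    by (cases "i \<le> j")
       (auto simp: sMat_def svec_def Abs_upper_inverse min_absorb1 min_absorb2
          max_absorb1 max_absorb2 s[of i j])
  then show ?thesis by (simp add: vec_eq_iff)
qed

lemma upper_sum:
  "(\<Sum>p\<in>UNIV. h (Rep_upper p)) = (\<Sum>(i, j) | i \<le> j. h (i, j))" for h :: "'k::{finite,linorder} \<times> 'k \<Rightarrow> real"
  by (rule sum.reindex_bij_witness[where i = Abs_upper and j = Rep_upper])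
     (use Rep_upper in \<open>auto simp: Rep_upper_inverse Abs_upper_inverse case_prod_unfold\<close>)

lemma upper_split:
  fixes g :: "'k::{finite,linorder} \<Rightarrow> 'k \<Rightarrow> real"
  assumes s: "\<And>i j. g i j = g j i"
  shows "(\<Sum>i\<in>UNIV. \<Sum>j\<in>UNIV. g i j) = (\<Sum>(i, j) | i \<le> j. if i = j then g i j else 2 * g i j)"
proof -
  let ?g = "\<lambda>(i, j). g i j"
  have "(\<Sum>i\<in>UNIV. \<Sum>j\<in>UNIV. g i j) = sum ?g UNIV"
    by (simp add: sum.cartesian_product)
  also have "UNIV = {(i, j). i \<le> j} \<union> {(i :: 'k, j). j < i}" by auto
  also have "sum ?g \<dots> = sum ?g {(i, j). i \<le> j} + sum ?g {(i, j). j < i}"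
    by (rule sum.union_disjoint) auto
  also have "sum ?g {(i, j). j < i} = sum ?g {(i, j). i < j}"
    by (rule sum.reindex_bij_witness[where i = prod.swap and j = prod.swap]) (auto intro: s)
  also have "\<dots> = sum (\<lambda>(i, j). if i = j then 0 else g i j) {(i, j). i \<le> j}"
    by (rule sum.mono_neutral_cong_left) (auto simp: less_le split: if_splits)
  finally show ?thesis
    by (simp add: sum.distrib[symmetric] case_prod_unfold if_distrib cong: if_cong)
qed

lemma svec_isometry:
  assumes "sym_mat B" "sym_mat D" shows "svec B \<bullet> svec D = B \<bullet> D"
proof -
  have s: "B $ i $ j * D $ i $ j = B $ j $ i * D $ j $ i" for i j
    using assms by (simp add: sym_mat_def transpose_def vec_eq_iff)
  have "svec B \<bullet> svec D = (\<Sum>p\<in>UNIV. (\<lambda>(i, j). if i = j then B $ i $ j * D $ i $ j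
      else 2 * (B $ i $ j * D $ i $ j)) (Rep_upper p))"
    unfolding inner_vec_def by (rule sum.cong) (auto simp: svec_def split: prod.splits)
  also have "\<dots> = B \<bullet> D"
    unfolding upper_sum by (simp add: inner_vec_def upper_split[OF s])
  finally show ?thesis .
qed

lemma card_upper: "CARD('k::{finite,linorder} upper) = CARD('k) * (CARD('k) + 1) div 2"
proof -
  have u: "CARD('k upper) = card {(i :: 'k, j). i \<le> j}"
    unfolding UNIV_upper
    by (subst card_image) (auto intro: inj_onI simp: Abs_upper_inject case_prod_unfold)
  have sw: "card {(i :: 'k, j). j \<le> i} = card {(i :: 'k, j). i \<le> j}"
    by (rule bij_betw_same_card[where f = prod.swap])
       (auto intro!: bij_betwI[where g = prod.swap])
  have dg: "{(i :: 'k, j). i \<le> j} \<inter> {(i, j). j \<le> i} = (\<lambda>i. (i, i)) ` UNIV" by auto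
  have "{(i :: 'k, j). i \<le> j} \<union> {(i, j). j \<le> i} = UNIV" by auto
  then have "2 * card {(i :: 'k, j). i \<le> j} = CARD('k \<times> 'k) + CARD('k)"
    using card_Un_Int[of "{(i :: 'k, j). i \<le> j}" "{(i, j). j \<le> i}"]
    by (simp add: sw dg card_image inj_on_def)
  then show ?thesis unfolding u by (simp add: card_cartesian_product)
qed

section \<open>The data and the operators\<close>

definition KK :: "real ^ 'k ^ 'k \<Rightarrow> real ^ 'k ^ 'k" where
  "KK B = (\<chi> i j. B $ i $ i) + (\<chi> i j. B $ j $ j) - 2 *\<^sub>R B"

definition YYx :: "real ^ 'r ^ 'm \<Rightarrow> real ^ ('r \<times> 'n::finite) \<Rightarrow> real ^ ('n + 'm) ^ ('n + 'm)" where
  "YYx A x = (1 / sqrt 2) *\<^sub>R blockmat 0 (Mat x ** transpose A) (A ** transpose (Mat x)) 0"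

definition YYy :: "real ^ ('n::{finite,linorder}) upper \<Rightarrow> real ^ ('n + 'm::finite) ^ ('n + 'm)" where
  "YYy y = blockmat (sMat y) 0 0 0"

definition YY :: "real ^ 'r ^ 'm \<Rightarrow> real ^ ('r \<times> 'n::{finite,linorder}) \<Rightarrow> real ^ 'n upper
    \<Rightarrow> real ^ ('n + 'm) ^ ('n + 'm)" where
  "YY A x y = YYx A x + YYy y"

definition anchor_gram :: "real ^ 'r ^ 'm \<Rightarrow> real ^ ('n::finite + 'm) ^ ('n + 'm)" where
  "anchor_gram A = blockmat 0 0 0 (A ** transpose A)"

(* For symmetric H the operators KKx A H and KKy H take values in S^(n+m), but are typed as maps into
   all square matrices.  Their library adjoints, restricted to S^(n+m), are the adjoints of the
   operators with codomain S^(n+m). *)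

definition KKx :: "real ^ 'r ^ 'm \<Rightarrow> real ^ ('n::finite + 'm) ^ ('n + 'm) \<Rightarrow> real ^ ('r \<times> 'n)
    \<Rightarrow> real ^ ('n + 'm) ^ ('n + 'm)" where
  "KKx A H x = H \<odot> KK (YYx A x)"

definition KKy :: "real ^ ('n::{finite,linorder} + 'm::finite) ^ ('n + 'm) \<Rightarrow> real ^ 'n upper
    \<Rightarrow> real ^ ('n + 'm) ^ ('n + 'm)" where
  "KKy H y = H \<odot> KK (YYy y)"

(* A distance is specified exactly where W is positive; an upper (lower) bound exists exactly
   where Hu (Hl) is 1.  Of "n much larger than m" only n > m is recorded.  The
   specified anchor-anchor entries of E need not agree with the distances between rows of A. *)

locale snl_data =
  fixes A :: "real ^ 'r ^ 'm"
    and E W Ub Lb Hu Hl :: "real ^ ('n::finite + 'm) ^ ('n + 'm)"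
  assumes more_sensors: "CARD('m) < CARD('n)"
    and more_anchors: "CARD('r) < CARD('m)"
    and centered: "transpose A *v 1 = 0"
    and full_rank: "rank A = CARD('r)"
    and symmetric: "sym_mat E" "sym_mat W" "sym_mat Ub" "sym_mat Lb" "sym_mat Hu" "sym_mat Hl"
    and W_nonneg: "0 \<le> W"
    and W_anchors: "\<And>a b. a \<noteq> b \<Longrightarrow> 0 < W $ Inr a $ Inr b"
    and E_nonneg: "0 \<le> E"
    and E_unspecified: "\<And>i j. W $ i $ j = 0 \<Longrightarrow> E $ i $ j = 0"
    and Hu_01: "\<And>i j. Hu $ i $ j \<in> {0, 1}"
    and Hl_01: "\<And>i j. Hl $ i $ j \<in> {0, 1}"
    and Ub_nonneg: "\<And>i j. Hu $ i $ j = 1 \<Longrightarrow> 0 \<le> Ub $ i $ j"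
    and Lb_nonneg: "\<And>i j. Hl $ i $ j = 1 \<Longrightarrow> 0 \<le> Lb $ i $ j"

section \<open>The optimization problem and its dual\<close>

definition f3 :: "real ^ 'r ^ 'm \<Rightarrow> real ^ ('n::{finite,linorder} + 'm) ^ ('n + 'm) \<Rightarrow> real ^ ('n + 'm) ^ ('n + 'm)
    \<Rightarrow> real ^ ('r \<times> 'n) \<Rightarrow> real ^ 'n upper \<Rightarrow> real" where
  "f3 A W Ebar x y = (1 / 2) * (norm (W \<odot> KK (YY A x y) - Ebar))\<^sup>2"

definition primal_feasible where
  "primal_feasible A Hu Ubar Hl Lbar x y \<longleftrightarrow>
     Hu \<odot> KK (YY A x y) - Ubar \<le> 0 \<and>
     Lbar - Hl \<odot> KK (YY A x y) \<le> 0 \<and>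
     (1 / 2) *\<^sub>R (Mat x ** transpose (Mat x)) - sMat y \<preceq> 0"

definition solves_primal where
  "solves_primal A W Ebar Hu Ubar Hl Lbar x y \<longleftrightarrow>
     primal_feasible A Hu Ubar Hl Lbar x y \<and>
     (\<forall>x' y'. primal_feasible A Hu Ubar Hl Lbar x' y' \<longrightarrow> f3 A W Ebar x y \<le> f3 A W Ebar x' y')"

definition Lagrangian where
  "Lagrangian A W Ebar Hu Ubar Hl Lbar x y Lu Ll Lam =
     f3 A W Ebar x y
     + Lu \<bullet> (Hu \<odot> KK (YY A x y) - Ubar)
     + Ll \<bullet> (Lbar - Hl \<odot> KK (YY A x y))
     + Lam \<bullet> ((1 / 2) *\<^sub>R (Mat x ** transpose (Mat x)) - sMat y)"

definition dual_feasible where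
  "dual_feasible A W Ebar Hu Ubar Hl Lbar x y Lu Ll Lam \<longleftrightarrow>
     sym_mat Lu \<and> sym_mat Ll \<and> sym_mat Lam \<and>
     GDERIV (\<lambda>x'. Lagrangian A W Ebar Hu Ubar Hl Lbar x' y Lu Ll Lam) x :> 0 \<and>
     GDERIV (\<lambda>y'. Lagrangian A W Ebar Hu Ubar Hl Lbar x y' Lu Ll Lam) y :> 0 \<and>
     0 \<le> Lu \<and> 0 \<le> Ll \<and> 0 \<preceq> Lam"

definition solves_dual where
  "solves_dual A W Ebar Hu Ubar Hl Lbar x y Lu Ll Lam \<longleftrightarrow>
     dual_feasible A W Ebar Hu Ubar Hl Lbar x y Lu Ll Lam \<and>
     (\<forall>x' y' Lu' Ll' Lam'. dual_feasible A W Ebar Hu Ubar Hl Lbar x' y' Lu' Ll' Lam' \<longrightarrow>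
        Lagrangian A W Ebar Hu Ubar Hl Lbar x' y' Lu' Ll' Lam'
          \<le> Lagrangian A W Ebar Hu Ubar Hl Lbar x y Lu Ll Lam)"

definition snl_optimal where
  "snl_optimal A W Ebar Hu Ubar Hl Lbar x y Lu Ll Lam \<longleftrightarrow>
     solves_primal A W Ebar Hu Ubar Hl Lbar x y \<and>
     solves_dual A W Ebar Hu Ubar Hl Lbar x y Lu Ll Lam"

end

(* On pairs (x, y) the Lagrangian is a convex quadratic function, the sum of the least squares term
   f3 and a multiple of the slack, so the sufficiency of the three conditions is weak duality.  For the
   necessity no constraint qualification is available.  Instead, scale the multipliers of a dual
   optimal point by 1 - t: the stationarity equations remain solvable, and the dual objective grows by
   t * slack - O(t^2), where slack is the total complementarity
   <Lambda_u, S_u> + <Lambda_l, S_l> + <Lambda, Z>.  Optimality forces slack = 0, and as all three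
   summands are nonnegative, each of them vanishes. *)

theory Submission
  imports Defs
begin

section \<open>Positive semidefinite matrices\<close>

lemma sym_mat_iff: "sym_mat B \<longleftrightarrow> (\<forall>i j. B $ i $ j = B $ j $ i)"
  by (auto simp: sym_mat_def transpose_def vec_eq_iff)

lemma sym_mat_inner_mult:
  assumes "sym_mat B" shows "u \<bullet> (B *v v) = v \<bullet> (B *v u)"
  using assms dot_lmul_matrix[of u B v] by (simp add: sym_mat_def inner_commute flip: transpose_matrix_vector)

text \<open>Along \<open>v + t *\<^sub>R u\<close> with \<open>u = B *v v\<close> the form is
  \<open>2 * t * (u \<bullet> u) + t\<^sup>2 * b\<close>; for nonzero \<open>u\<close> a small
  negative \<open>t\<close> would make it negative.\<close>

lemma psd_null_vector:
  assumes B: "psd B" and v: "v \<bullet> (B *v v) = 0"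
  shows "B *v v = 0"
proof -
  define u where "u = B *v v"
  define b where "b = u \<bullet> (B *v u)"
  have b: "0 \<le> b" using B by (simp add: psd_def b_def)
  have s: "v \<bullet> (B *v u) = u \<bullet> u"
    using B sym_mat_inner_mult[of B v u] by (simp add: psd_def u_def)
  have vu: "v \<bullet> u = 0" using v by (simp add: u_def)
  have q: "0 \<le> 2 * t * (u \<bullet> u) + t\<^sup>2 * b" for t
  proof -
    have "0 \<le> (v + t *\<^sub>R u) \<bullet> (B *v (v + t *\<^sub>R u))" using B by (simp add: psd_def)
    also have "\<dots> = 2 * t * (u \<bullet> u) + t\<^sup>2 * b"
      by (simp add: matrix_vector_right_distrib matrix_vector_mult_scaleR inner_add vu s
          u_def[symmetric] b_def power2_eq_square algebra_simps)
    finally show ?thesis .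
  qed
  have "u \<bullet> u = 0"
  proof (rule ccontr)
    assume "u \<bullet> u \<noteq> 0"
    then have p: "0 < u \<bullet> u" by simp
    \<comment> \<open>Adding 1 to \<open>b\<close> keeps the denominator positive also when
      \<open>b = 0\<close>, and at this \<open>t\<close> the linear term still dominates the
      quadratic one.\<close>
    define t where "t = - (u \<bullet> u) / (b + 1)"
    have tb: "t * (b + 1) = - (u \<bullet> u)" using b by (simp add: t_def)
    have t: "t < 0" using p b by (simp add: t_def)
    have "2 * t * (u \<bullet> u) + t\<^sup>2 * b = t * (2 * (u \<bullet> u) + t * (b + 1) - t)"
      by (simp add: power2_eq_square algebra_simps)
    also have "\<dots> = t * (u \<bullet> u - t)" by (simp only: tb) simp
    also have "\<dots> < 0" by (rule mult_neg_pos) (use t p in linarith)+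
    finally show False using q[of t] by simp
  qed
  then show ?thesis by (simp add: u_def)
qed

text \<open>The form is nonnegative at \<open>u - (c / a) *\<^sub>R v\<close>; for an isotropic
  \<open>v\<close> both sides vanish because \<open>B *v v = 0\<close>.\<close>

lemma psd_Cauchy_Schwarz:
  assumes B: "psd B"
  shows "(u \<bullet> (B *v v))\<^sup>2 \<le> (u \<bullet> (B *v u)) * (v \<bullet> (B *v v))"
proof (cases "v \<bullet> (B *v v) = 0")
  case True
  then show ?thesis using psd_null_vector[OF B True] by simp
next
  case False
  define a where "a = v \<bullet> (B *v v)"
  define c where "c = u \<bullet> (B *v v)"
  have a: "0 < a" using False B by (simp add: psd_def a_def less_le)
  have s: "v \<bullet> (B *v u) = c"
    using B sym_mat_inner_mult[of B v u] by (simp add: psd_def c_def)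
  define w where "w = u - (c / a) *\<^sub>R v"
  have "0 \<le> w \<bullet> (B *v w)" using B by (simp add: psd_def)
  also have "\<dots> = u \<bullet> (B *v u) - c\<^sup>2 / a"
    using a by (simp add: w_def matrix_vector_mult_diff_distrib matrix_vector_mult_scaleR inner_diff s
        flip: a_def c_def) (simp add: field_simps power2_eq_square)
  finally show ?thesis using a by (simp add: field_simps flip: a_def c_def)
qed

section \<open>Rank-one updates and pairs of semidefinite matrices\<close>

definition outer :: "real ^ 'k \<Rightarrow> real ^ 'k ^ 'k" where
  "outer v = (\<chi> i j. v $ i * v $ j)"

lemma outer_mult: "outer v *v w = (v \<bullet> w) *\<^sub>R v"
  by (simp add: outer_def matrix_vector_mult_def vec_eq_iff inner_vec_def sum_distrib_left sum_distrib_right ac_simps)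

lemma mult_outer: "B ** outer v = (\<chi> i j. (B *v v) $ i * v $ j)"
  by (simp add: outer_def matrix_matrix_mult_def matrix_vector_mult_def vec_eq_iff sum_distrib_left ac_simps)

lemma inner_outer: "B \<bullet> outer v = v \<bullet> (B *v v)"
  by (simp add: outer_def matrix_vector_mult_def inner_vec_def sum_distrib_left ac_simps)

lemma quadratic_form_axis: "axis i 1 \<bullet> (B *v axis i 1) = B $ i $ i" for B :: "real ^ 'k ^ 'k"
  by (simp add: matrix_vector_mult_basis column_def inner_axis')

text \<open>Nonnegativity of the form at \<open>u\<close> is the Cauchy-Schwarz inequality for
  \<open>u\<close> and the \<open>i\<close>-th basis vector. Row and column \<open>i\<close> of the
  difference vanish: it is the Schur complement padded with zeros, so the matrix size stays
  fixed.\<close>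

lemma psd_schur_complement:
  assumes D: "psd D" and i: "D $ i $ i \<noteq> 0"
  shows "psd (D - (1 / D $ i $ i) *\<^sub>R outer (column i D))"
proof -
  let ?v = "column i D"
  have v: "?v = D *v axis i 1" by (simp add: matrix_vector_mult_basis)
  have pos: "0 < D $ i $ i"
    using D i quadratic_form_axis[of i D] by (auto simp: psd_def less_le dest: spec[of _ "axis i 1"])
  have "sym_mat (D - (1 / D $ i $ i) *\<^sub>R outer ?v)"
    using D by (auto simp: psd_def sym_mat_iff outer_def ac_simps)
  moreover have "0 \<le> u \<bullet> ((D - (1 / D $ i $ i) *\<^sub>R outer ?v) *v u)" for u
  proof -
    have "(u \<bullet> ?v)\<^sup>2 \<le> (u \<bullet> (D *v u)) * D $ i $ i"
      using psd_Cauchy_Schwarz[OF D, of u "axis i 1"] by (simp only: quadratic_form_axis v)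
    then have "(u \<bullet> ?v)\<^sup>2 / D $ i $ i \<le> u \<bullet> (D *v u)"
      using pos by (simp add: field_simps)
    then show ?thesis
      by (simp add: matrix_vector_mult_diff_rdistrib scaleR_matrix_vector_assoc[symmetric] outer_mult
          inner_diff inner_commute power2_eq_square)
  qed
  ultimately show ?thesis by (simp add: psd_def)
qed

text \<open>Induction on the number of nonzero diagonal entries: splitting off a rank-one term leaves a
  Schur complement with one more zero on the diagonal.\<close>

lemma psd_inner_nonneg_and_mult_eq_0:
  assumes B: "psd B" and D: "psd D"
  shows "0 \<le> B \<bullet> D \<and> (B \<bullet> D = 0 \<longrightarrow> B ** D = 0)"
  using D
proof (induction "card {i. D $ i $ i \<noteq> 0}" arbitrary: D rule: less_induct)
  case less
  \<comment> \<open>A zero diagonal entry makes a basis vector isotropic, so it lies in the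
    kernel.\<close>
  have col0: "column j D = 0" if "D $ j $ j = 0" for j
    using psd_null_vector[OF less.prems, of "axis j 1"] that
    by (simp only: quadratic_form_axis) (simp add: matrix_vector_mult_basis)
  show ?case
  proof (cases "\<forall>i. D $ i $ i = 0")
    case True
    then have D: "D = 0" using col0 by (simp add: vec_eq_iff column_def)
    show ?thesis unfolding D by (simp add: matrix_matrix_mult_def vec_eq_iff)
  next
    case False
    then obtain i where i: "D $ i $ i \<noteq> 0" by blast
    define a where "a = 1 / D $ i $ i"
    define v where "v = column i D"
    define S where "S = D - a *\<^sub>R outer v"
    have a: "0 < a"
      using less.prems i quadratic_form_axis[of i D]
      by (auto simp: psd_def less_le a_def dest: spec[of _ "axis i 1"])
    have S: "psd S" unfolding S_def a_def v_def by (rule psd_schur_complement[OF less.prems i])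
    have "S $ i $ i = 0" using i by (simp add: S_def a_def v_def outer_def column_def)
    \<comment> \<open>Old zeros on the diagonal survive, since \<open>v\<close> has entry 0 at such
      a \<open>j\<close>.\<close>
    moreover have "S $ j $ j = 0" if "D $ j $ j = 0" for j
    proof -
      have "D $ j $ i = 0"
        using less.prems col0[OF that] by (auto simp: psd_def sym_mat_iff column_def vec_eq_iff)
      then show ?thesis using that by (simp add: S_def v_def outer_def column_def)
    qed
    ultimately have "{j. S $ j $ j \<noteq> 0} \<subset> {j. D $ j $ j \<noteq> 0}" using i by blast
    then have IH: "0 \<le> B \<bullet> S" "B \<bullet> S = 0 \<longrightarrow> B ** S = 0"
      using less.hyps[OF psubset_card_mono S] by auto
    have D_eq: "D = S + a *\<^sub>R outer v" by (simp add: S_def)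
    have inner: "B \<bullet> D = B \<bullet> S + a * (v \<bullet> (B *v v))"
      by (simp add: D_eq inner_add inner_outer)
    have nn: "0 \<le> v \<bullet> (B *v v)" using B by (simp add: psd_def)
    \<comment> \<open>Both summands of \<open>inner\<close> are nonnegative, so both vanish: the
      induction hypothesis settles \<open>S\<close>, and isotropy of \<open>v\<close> settles the
      rank-one term.\<close>
    have "B ** D = 0" if "B \<bullet> D = 0"
    proof -
      have z: "B \<bullet> S = 0" "v \<bullet> (B *v v) = 0"
        using that inner IH(1) nn a by (auto simp: add_nonneg_eq_0_iff)
      have "B *v v = 0" by (rule psd_null_vector[OF B z(2)])
      then have "B ** outer v = 0" by (simp add: mult_outer vec_eq_iff)
      then show ?thesis using IH(2) z(1)
        by (simp add: D_eq matrix_add_ldistrib matrix_scalar_ac flip: scalar_matrix_assoc)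
    qed
    then show ?thesis using inner IH(1) nn a by simp
  qed
qed

lemma psd_inner_nonneg: "psd B \<Longrightarrow> psd D \<Longrightarrow> 0 \<le> B \<bullet> D"
  using psd_inner_nonneg_and_mult_eq_0 by blast

text \<open>The right-hand side is the trace of the product, so a zero product forces a zero inner
  product.\<close>

lemma inner_eq_sum_diag:
  assumes "sym_mat D" shows "B \<bullet> D = (\<Sum>i\<in>UNIV. (B ** D) $ i $ i)"
  using assms by (simp add: sym_mat_iff inner_vec_def matrix_matrix_mult_def)

lemma psd_inner_eq_0_iff: "psd B \<Longrightarrow> psd D \<Longrightarrow> B \<bullet> D = 0 \<longleftrightarrow> B ** D = 0"
  using psd_inner_nonneg_and_mult_eq_0[of B D] inner_eq_sum_diag[of D B] by (auto simp: psd_def)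

lemma psd_scaleR: "psd B \<Longrightarrow> 0 \<le> c \<Longrightarrow> psd (c *\<^sub>R B)"
  by (simp add: psd_def sym_mat_iff scaleR_matrix_vector_assoc[symmetric])

lemma psd_gram: "psd (X ** transpose X)" for X :: "real ^ 'r ^ 'k"
proof -
  have "v \<bullet> ((X ** transpose X) *v v) = (transpose X *v v) \<bullet> (transpose X *v v)" for v
    by (simp add: dot_lmul_matrix[symmetric] flip: matrix_vector_mul_assoc)
  then show ?thesis by (simp add: psd_def sym_mat_def matrix_transpose_mul)
qed

section \<open>Trace inner products and entrywise nonnegativity\<close>

text \<open>Both sides are the trace of \<open>B ** Y ** transpose X\<close>.\<close>

lemma inner_mult_transpose: "B \<bullet> (X ** transpose Y) = X \<bullet> (B ** Y)" for B :: "real ^ 'k ^ 'j"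
proof -
  have "B \<bullet> (X ** transpose Y) = (\<Sum>i\<in>UNIV. \<Sum>j\<in>UNIV. \<Sum>k\<in>UNIV. X $ i $ k * (B $ i $ j * Y $ j $ k))"
    by (simp add: inner_vec_def matrix_matrix_mult_def transpose_def sum_distrib_left ac_simps)
  also have "\<dots> = (\<Sum>i\<in>UNIV. \<Sum>k\<in>UNIV. \<Sum>j\<in>UNIV. X $ i $ k * (B $ i $ j * Y $ j $ k))"
    by (intro sum.cong refl sum.swap)
  also have "\<dots> = X \<bullet> (B ** Y)"
    by (simp add: inner_vec_def matrix_matrix_mult_def sum_distrib_left)
  finally show ?thesis .
qed

lemma inner_transpose: "transpose B \<bullet> transpose D = B \<bullet> D" for B :: "real ^ 'k ^ 'j"
  unfolding inner_vec_def transpose_def by (simp, subst sum.swap, rule refl)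

lemma inner_nonneg_vec: "0 \<le> u \<bullet> v" if "0 \<le> u" "0 \<le> v" for u v :: "real ^ 'k"
  using that by (auto simp: inner_vec_def less_eq_vec_def intro: sum_nonneg)

lemma inner_eq_0_iff_times: "u \<bullet> v = 0 \<longleftrightarrow> u * v = 0" if "0 \<le> u" "0 \<le> v" for u v :: "real ^ 'k"
  using that by (simp add: inner_vec_def less_eq_vec_def vec_eq_iff sum_nonneg_eq_0_iff)

lemma inner_nonneg_mat: "0 \<le> B \<bullet> D" if "0 \<le> B" "0 \<le> D" for B D :: "real ^ 'k ^ 'j"
  using that by (auto simp: inner_vec_def[of B] less_eq_vec_def intro!: sum_nonneg inner_nonneg_vec)

text \<open>The factor \<open>sqrt 2\<close> preserves signs, and symmetry recovers the lower
  triangle that \<open>svec\<close> drops.\<close>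

lemma svec_nonneg_iff:
  assumes "sym_mat B" shows "0 \<le> svec B \<longleftrightarrow> 0 \<le> B"
proof
  assume b: "0 \<le> svec B"
  have "0 \<le> sMat (svec B)" using b by (simp add: less_eq_vec_def sMat_def)
  then show "0 \<le> B" by (simp add: sMat_svec[OF assms])
next
  assume "0 \<le> B"
  then show "0 \<le> svec B" by (auto simp: less_eq_vec_def svec_def split: prod.splits)
qed

section \<open>Convex quadratic functions\<close>

text \<open>If \<open>v\<close> is orthogonal to the range of \<open>S\<close>, then
  \<open>v \<bullet> S v\<close>, a sum of \<open>(norm (M v))\<^sup>2\<close> and a nonnegative
  term, is 0. Hence \<open>M v = 0\<close>, and \<open>v\<close> is orthogonal to
  \<open>adjoint M r\<close> as well.\<close>

lemma range_adjoint_normal_equation: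
  fixes M :: "'z::euclidean_space \<Rightarrow> 'w::euclidean_space" and P :: "'z \<Rightarrow> 'z"
  assumes M: "linear M" and P: "linear P" and self: "\<And>u v. u \<bullet> P v = v \<bullet> P u"
    and nonneg: "\<And>u. 0 \<le> u \<bullet> P u"
  shows "\<exists>d. adjoint M (M d) + P d = adjoint M r"
proof -
  define S where "S d = adjoint M (M d) + P d" for d
  have aw: "u \<bullet> adjoint M w = M u \<bullet> w" for u w by (rule adjoint_works[OF M])
  have S: "linear S"
    unfolding S_def by (intro linear_compose_add P linear_compose[OF M adjoint_linear[OF M], unfolded o_def])
  have S_self: "u \<bullet> S v = v \<bullet> S u" for u v
    by (simp add: S_def inner_add_right aw self[of u v] inner_commute)
  \<comment> \<open>The orthogonal splitting along the range of \<open>S\<close>; it remains to show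
    \<open>v = 0\<close>.\<close>
  obtain u v where u: "u \<in> span (range S)" and v: "\<And>w. w \<in> span (range S) \<Longrightarrow> orthogonal v w"
    and eq: "adjoint M r = u + v"
    using orthogonal_subspace_decomp_exists[of "range S" "adjoint M r"] by blast
  have span: "span (range S) = range S"
    using S by (metis linear_span_image span_UNIV)
  have vS: "v \<bullet> S w = 0" for w
    using v[of "S w"] by (simp add: span orthogonal_def)
  have "(norm (M v))\<^sup>2 + v \<bullet> P v = 0"
    using vS[of v] by (simp add: S_def inner_add_right aw power2_norm_eq_inner)
  then have "M v = 0" using nonneg[of v] by (simp add: add_nonneg_eq_0_iff)
  then have "v \<bullet> adjoint M r = 0" by (simp add: aw)
  moreover have "v \<bullet> u = 0" using v[OF u] by (simp add: orthogonal_def)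
  ultimately have "v = 0" by (simp add: eq inner_add_right)
  then have "adjoint M r \<in> range S" using u eq span by simp
  then show ?thesis by (auto simp: S_def)
qed

text \<open>The least squares term is kept apart because damping rescales only the remaining
  terms.\<close>

definition quad where
  "quad M e P c k z = (1 / 2) * (norm (M z - e))\<^sup>2 + ((1 / 2) * (z \<bullet> P z) + c \<bullet> z + k :: real)"

definition quad_grad where
  "quad_grad M e P c z = adjoint M (M z - e) + (P z + c)"

locale convex_quadratic =
  fixes M :: "'z::euclidean_space \<Rightarrow> 'w::euclidean_space" and P :: "'z \<Rightarrow> 'z"
  assumes linear_M: "linear M" and linear_P: "linear P"
    and self_adjoint: "\<And>u v. u \<bullet> P v = v \<bullet> P u"
    and nonneg: "\<And>u. 0 \<le> u \<bullet> P u"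
begin

lemma inner_adjoint: "u \<bullet> adjoint M w = M u \<bullet> w"
  by (rule adjoint_works[OF linear_M])

text \<open>The second-order Taylor expansion is exact here; minimality of stationary points and the
  estimate under damping are both read off from it.\<close>

lemma quad_add:
  "quad M e P c k (z + d) = quad M e P c k z + d \<bullet> quad_grad M e P c z
     + ((1 / 2) * (norm (M d))\<^sup>2 + (1 / 2) * (d \<bullet> P d))"
proof -
  have "M (z + d) - e = (M z - e) + M d" by (simp add: linear_add[OF linear_M])
  then have "(norm (M (z + d) - e))\<^sup>2 = (norm (M z - e))\<^sup>2 + 2 * (M d \<bullet> (M z - e)) + (norm (M d))\<^sup>2"
    by (simp only: power2_norm_eq_inner) (simp add: inner_add inner_commute)
  then show ?thesis
    by (simp add: quad_def quad_grad_def linear_add[OF linear_P] inner_add inner_adjoint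
        self_adjoint[of z d] inner_commute[of c] algebra_simps)
qed

lemma quad_le_of_grad_eq_0: "quad_grad M e P c z = 0 \<Longrightarrow> quad M e P c k z \<le> quad M e P c k z'"
  using quad_add[of e c k z "z' - z"] nonneg[of "z' - z"] by simp

lemma GDERIV_quad: "GDERIV (quad M e P c k) z :> quad_grad M e P c z"
proof -
  have M: "(M has_derivative M) F" and P: "(P has_derivative P) F" for F
    using linear_M linear_P by (auto intro: linear_imp_has_derivative)
  have "((\<lambda>v. (1 / 2) * ((M v - e) \<bullet> (M v - e)) + ((1 / 2) * (v \<bullet> P v) + c \<bullet> v + k)) has_derivative
      (\<lambda>h. (1 / 2) * ((M z - e) \<bullet> M h + M h \<bullet> (M z - e)) + ((1 / 2) * (z \<bullet> P h + h \<bullet> P z) + c \<bullet> h))) (at z)"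
    by (rule has_derivative_eq_rhs, (rule derivative_intros M P)+) (simp add: fun_eq_iff)
  also have "(\<lambda>h. (1 / 2) * ((M z - e) \<bullet> M h + M h \<bullet> (M z - e)) + ((1 / 2) * (z \<bullet> P h + h \<bullet> P z) + c \<bullet> h))
      = (\<lambda>h. h \<bullet> quad_grad M e P c z)"
    by (simp add: fun_eq_iff quad_grad_def inner_add_right inner_adjoint self_adjoint[of z]
        inner_commute[of "M z - e"] inner_commute[of c])
  finally show ?thesis
    by (simp add: gderiv_def quad_def[abs_def] power2_norm_eq_inner)
qed

text \<open>Damping everything except the least squares term by the factor 1 - t perturbs the gradient at
  the minimizer by t * adjoint M r only, which lies in the range of the new Hessian; hence the minimum
  is still attained, and it drops by a term quadratic in t.\<close>

lemma damped_minimizer: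
  assumes grad: "quad_grad M e P c z = 0" and t: "t < 1"
  shows "\<exists>d. quad_grad M e (\<lambda>v. (1 - t) *\<^sub>R P v) ((1 - t) *\<^sub>R c) (z + d) = 0 \<and>
    quad M e (\<lambda>v. (1 - t) *\<^sub>R P v) ((1 - t) *\<^sub>R c) ((1 - t) * k) z - (1 / 2) * t\<^sup>2 * (norm (M z - e))\<^sup>2
      \<le> quad M e (\<lambda>v. (1 - t) *\<^sub>R P v) ((1 - t) *\<^sub>R c) ((1 - t) * k) (z + d)"
proof -
  define Q where "Q v = (1 - t) *\<^sub>R P v" for v
  define r where "r = M z - e"
  interpret Q: convex_quadratic M Q
  proof (rule convex_quadratic.intro)
    show "linear M" by (rule linear_M)
    show "linear Q" unfolding Q_def by (rule linear_compose_scale_right[OF linear_P])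
    show "u \<bullet> Q v = v \<bullet> Q u" for u v by (simp add: Q_def self_adjoint[of u])
    show "0 \<le> u \<bullet> Q u" for u using t nonneg by (simp add: Q_def)
  qed
  \<comment> \<open>The right-hand side is the negative of the gradient \<open>gz\<close> computed
    below, so \<open>d\<close> is a Newton step to the new stationary point.\<close>
  obtain d where d: "adjoint M (M d) + Q d = adjoint M ((- t) *\<^sub>R r)"
    using range_adjoint_normal_equation[OF linear_M Q.linear_P Q.self_adjoint Q.nonneg] by blast
  have adj: "linear (adjoint M)" by (rule adjoint_linear[OF linear_M])
  \<comment> \<open>Stationarity balances the two groups of terms; after damping the second group,
    \<open>t *\<^sub>R adjoint M r\<close> is left over.\<close>
  have "P z + c = - adjoint M r" using grad by (simp add: quad_grad_def r_def eq_neg_iff_add_eq_0 add.commute)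
  then have "Q z + (1 - t) *\<^sub>R c = (1 - t) *\<^sub>R (- adjoint M r)"
    by (simp add: Q_def flip: scaleR_add_right)
  then have gz: "quad_grad M e Q ((1 - t) *\<^sub>R c) z = t *\<^sub>R adjoint M r"
    by (simp add: quad_grad_def r_def[symmetric] algebra_simps)
  have "quad_grad M e Q ((1 - t) *\<^sub>R c) (z + d) = quad_grad M e Q ((1 - t) *\<^sub>R c) z + (adjoint M (M d) + Q d)"
    by (simp add: quad_grad_def linear_add[OF linear_M] linear_add[OF Q.linear_P]
        linear_add[OF adj] linear_diff[OF adj])
  also have "\<dots> = 0" by (simp add: gz d linear_scale[OF adj] linear_neg[OF adj])
  finally have g0: "quad_grad M e Q ((1 - t) *\<^sub>R c) (z + d) = 0" .
  \<comment> \<open>Completing the square bounds the first-order loss by a term quadratic in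
    \<open>t\<close> that does not involve \<open>d\<close>.\<close>
  have "0 \<le> (norm (M d + t *\<^sub>R r))\<^sup>2" by simp
  also have "\<dots> = (norm (M d))\<^sup>2 + 2 * t * (M d \<bullet> r) + t\<^sup>2 * (norm r)\<^sup>2"
    by (simp only: power2_norm_eq_inner) (simp add: inner_add inner_commute power2_eq_square)
  finally have "- (1 / 2) * t\<^sup>2 * (norm r)\<^sup>2 \<le> t * (M d \<bullet> r) + (1 / 2) * (norm (M d))\<^sup>2" by simp
  then show ?thesis
    using g0 Q.nonneg[of d] unfolding Q_def[symmetric, abs_def]
    by (intro exI[of _ d]) (simp add: Q.quad_add gz inner_adjoint flip: r_def)
qed

end

section \<open>The Lagrangian as a convex quadratic function\<close>

lemma linear_sMat: "linear sMat"
  by (rule linearI) (simp_all add: sMat_def vec_eq_iff distrib_left)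

lemma linear_svec: "linear svec"
  by (rule linearI) (simp_all add: svec_def vec_eq_iff distrib_left case_prod_unfold)

lemma linear_KK: "linear KK"
  by (rule linearI) (simp_all add: KK_def vec_eq_iff algebra_simps)

lemma linear_YYx: "linear (YYx A)"
  by (rule linearI)
     (simp_all add: YYx_def blockmat_def Mat_def vec_eq_iff matrix_matrix_mult_def transpose_def
       sum.distrib sum_distrib_left add_divide_distrib sum_divide_distrib algebra_simps split: sum.splits)

lemma linear_YYy: "linear YYy"
  by (rule linearI)
     (simp_all add: YYy_def blockmat_def vec_eq_iff linear_add[OF linear_sMat] linear_scale[OF linear_sMat]
       split: sum.splits)

lemma linear_KKx: "linear (KKx A H)"
  by (rule linearI)
     (simp_all add: KKx_def linear_add[OF linear_YYx] linear_add[OF linear_KK]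
       linear_scale[OF linear_YYx] linear_scale[OF linear_KK] vec_eq_iff algebra_simps)

lemma linear_KKy: "linear (KKy H)"
  by (rule linearI)
     (simp_all add: KKy_def linear_add[OF linear_YYy] linear_add[OF linear_KK]
       linear_scale[OF linear_YYy] linear_scale[OF linear_KK] vec_eq_iff algebra_simps)

text \<open>Both variables form one point of a product space, so that the results on
  \<open>quad\<close> apply and the two stationarity equations become one.\<close>

definition KKxy where
  "KKxy A H z = KKx A H (fst z) + KKy H (snd z)"

lemma hadamard_KK_YY: "H * KK (YY A x y) = KKxy A H (x, y)"
  by (simp add: KKxy_def KKx_def KKy_def YY_def linear_add[OF linear_KK] vec_eq_iff algebra_simps)

lemma linear_KKxy: "linear (KKxy A H)"
  unfolding KKxy_def
  by (intro linear_compose_add linear_compose[OF linear_fst linear_KKx, unfolded o_def]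
      linear_compose[OF linear_snd linear_KKy, unfolded o_def])

lemma adjoint_KKxy: "adjoint (KKxy A H) B = (adjoint (KKx A H) B, adjoint (KKy H) B)"
proof -
  have "adjoint (KKxy A H) = (\<lambda>B. (adjoint (KKx A H) B, adjoint (KKy H) B))"
    by (rule adjoint_unique)
       (simp add: KKxy_def inner_add_left adjoint_works[OF linear_KKx] adjoint_works[OF linear_KKy] inner_prod_def)
  then show ?thesis by simp
qed

text \<open>The Hessian of the matrix constraint term alone; the least squares part enters through
  \<open>KKxy\<close>. The second component is 0 because \<open>y\<close> occurs linearly in that
  term.\<close>

definition Lag_hess :: "real ^ 'n::finite ^ 'n \<Rightarrow> (real ^ ('r::finite \<times> 'n)) \<times> 'y::zero
    \<Rightarrow> (real ^ ('r \<times> 'n)) \<times> 'y" where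
  "Lag_hess Lam z = (mvec (Lam ** Mat (fst z)), 0)"

text \<open>The gradient of the multiplier terms that are linear in \<open>(x, y)\<close>.\<close>

definition Lag_lin where
  "Lag_lin A Hu Hl Lu Ll Lam = (adjoint (KKx A Hu) Lu - adjoint (KKx A Hl) Ll,
     adjoint (KKy Hu) Lu - adjoint (KKy Hl) Ll - svec Lam)"

lemma inner_mvec: "x \<bullet> mvec X = Mat x \<bullet> X"
proof -
  have "x \<bullet> mvec X = (\<Sum>(j, i)\<in>UNIV \<times> UNIV. x $ (j, i) * X $ i $ j)"
    by (simp add: inner_vec_def mvec_def case_prod_unfold)
  also have "\<dots> = (\<Sum>j\<in>UNIV. \<Sum>i\<in>UNIV. x $ (j, i) * X $ i $ j)"
    by (rule sum.cartesian_product[symmetric])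
  also have "\<dots> = Mat x \<bullet> X"
    by (subst sum.swap) (simp add: inner_vec_def Mat_def)
  finally show ?thesis .
qed

lemma inner_Lag_hess: "u \<bullet> Lag_hess Lam v = Lam \<bullet> (Mat (fst u) ** transpose (Mat (fst v)))"
  by (simp add: Lag_hess_def inner_prod_def inner_mvec inner_mult_transpose)

text \<open>The form at \<open>u\<close> is the inner product of \<open>Lam\<close> with a Gram
  matrix, hence of two semidefinite matrices.\<close>

lemma convex_quadratic_Lagrangian:
  assumes "psd Lam" shows "convex_quadratic (KKxy A W) (Lag_hess Lam)"
proof (rule convex_quadratic.intro)
  show "linear (KKxy A W)" by (rule linear_KKxy)
  show "linear (Lag_hess Lam)"
    by (rule linearI)
       (simp_all add: Lag_hess_def mvec_def Mat_def matrix_matrix_mult_def vec_eq_iff sum.distrib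
         sum_distrib_left algebra_simps)
  show "u \<bullet> Lag_hess Lam v = v \<bullet> Lag_hess Lam u" for u v
  proof -
    have "transpose Lam = Lam" using assms by (simp add: psd_def sym_mat_def)
    then show ?thesis
      using inner_transpose[of Lam "Mat (fst u) ** transpose (Mat (fst v))"]
      by (simp add: inner_Lag_hess matrix_transpose_mul)
  qed
  show "0 \<le> u \<bullet> Lag_hess Lam u" for u
    unfolding inner_Lag_hess by (rule psd_inner_nonneg[OF assms psd_gram])
qed

text \<open>Adjoints collect the linear terms; symmetry of \<open>Lam\<close> and the isometry of
  \<open>svec\<close> turn \<open>Lam \<bullet> sMat y\<close> into
  \<open>svec Lam \<bullet> y\<close>.\<close>

lemma Lagrangian_eq_quad:
  assumes "sym_mat Lam"
  shows "Lagrangian A W Ebar Hu Ubar Hl Lbar x y Lu Ll Lam =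
    quad (KKxy A W) Ebar (Lag_hess Lam) (Lag_lin A Hu Hl Lu Ll Lam) (Ll \<bullet> Lbar - Lu \<bullet> Ubar) (x, y)"
proof -
  have u: "(adjoint (KKx A H) B, adjoint (KKy H) B) \<bullet> (x, y) = B \<bullet> KKxy A H (x, y)" for H B
    using adjoint_works[OF linear_KKxy, of "(x, y)" A H B] by (simp only: adjoint_KKxy inner_commute)
  have l: "Lag_lin A Hu Hl Lu Ll Lam = (adjoint (KKx A Hu) Lu, adjoint (KKy Hu) Lu)
      - (adjoint (KKx A Hl) Ll, adjoint (KKy Hl) Ll) - (0, svec Lam)"
    by (simp add: Lag_lin_def)
  have s: "(0, svec Lam) \<bullet> (x, y) = Lam \<bullet> sMat y"
    using svec_isometry[OF assms sym_mat_sMat, of y] by (simp add: inner_prod_def)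
  show ?thesis
    unfolding Lagrangian_def quad_def f3_def hadamard_KK_YY inner_Lag_hess l inner_diff_left u s
    by (simp add: inner_diff_right)
qed

section \<open>Partial gradients and dual feasibility\<close>

lemma GDERIV_partial:
  assumes "GDERIV f (x, y) :> g"
  shows "GDERIV (\<lambda>x'. f (x', y)) x :> fst g" "GDERIV (\<lambda>y'. f (x, y')) y :> snd g"
proof -
  have f: "(f has_derivative (\<lambda>h. h \<bullet> g)) (at (x, y))" using assms by (simp add: gderiv_def)
  show "GDERIV (\<lambda>x'. f (x', y)) x :> fst g"
    unfolding gderiv_def
    by (rule has_derivative_eq_rhs, rule has_derivative_compose[where f = "\<lambda>x'. (x', y)" and g = f])
       (auto intro!: derivative_eq_intros f simp: inner_prod_def)
  show "GDERIV (\<lambda>y'. f (x, y')) y :> snd g"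
    unfolding gderiv_def
    by (rule has_derivative_eq_rhs, rule has_derivative_compose[where f = "\<lambda>y'. (x, y')" and g = f])
       (auto intro!: derivative_eq_intros f simp: inner_prod_def)
qed

lemma GDERIV_unique:
  assumes "GDERIV f x :> g" "GDERIV f x :> g'" shows "g = g'"
proof -
  have "(\<lambda>h. h \<bullet> g) = (\<lambda>h. h \<bullet> g')"
    using assms unfolding gderiv_def by (rule has_derivative_unique)
  then have "(g - g') \<bullet> g = (g - g') \<bullet> g'" by metis
  then have "(g - g') \<bullet> (g - g') = 0" by (simp add: inner_diff_right)
  then show ?thesis by simp
qed

text \<open>Partial gradients are the components of the joint gradient, and gradients are unique. If
  \<open>Lam\<close> is not semidefinite, both sides are false.\<close>

lemma dual_feasible_iff:
  "dual_feasible A W Ebar Hu Ubar Hl Lbar x y Lu Ll Lam \<longleftrightarrow>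
     sym_mat Lu \<and> sym_mat Ll \<and> psd Lam \<and> 0 \<le> Lu \<and> 0 \<le> Ll \<and>
     quad_grad (KKxy A W) Ebar (Lag_hess Lam) (Lag_lin A Hu Hl Lu Ll Lam) (x, y) = 0"
proof (cases "psd Lam")
  case True
  then have sym: "sym_mat Lam" by (simp add: psd_def)
  let ?g = "quad_grad (KKxy A W) Ebar (Lag_hess Lam) (Lag_lin A Hu Hl Lu Ll Lam) (x, y)"
  note G = GDERIV_partial[OF convex_quadratic.GDERIV_quad[OF convex_quadratic_Lagrangian[OF True]]]
  have "GDERIV (\<lambda>x'. Lagrangian A W Ebar Hu Ubar Hl Lbar x' y Lu Ll Lam) x :> 0 \<longleftrightarrow> fst ?g = 0"
    unfolding Lagrangian_eq_quad[OF sym] using G(1) GDERIV_unique[OF G(1)] by metis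
  moreover have "GDERIV (\<lambda>y'. Lagrangian A W Ebar Hu Ubar Hl Lbar x y' Lu Ll Lam) y :> 0 \<longleftrightarrow> snd ?g = 0"
    unfolding Lagrangian_eq_quad[OF sym] using G(2) GDERIV_unique[OF G(2)] by metis
  ultimately show ?thesis
    using True by (auto simp: dual_feasible_def loewner_le_def psd_def prod_eq_iff)
qed (simp add: dual_feasible_def loewner_le_def)

section \<open>Duality\<close>

text \<open>The total complementarity, which is the amount by which the Lagrangian falls below the
  objective.\<close>

definition slack_inner where
  "slack_inner A Hu Ubar Hl Lbar x y Lu Ll Lam =
     Lu \<bullet> (Ubar - Hu * KK (YY A x y)) + Ll \<bullet> (Hl * KK (YY A x y) - Lbar)
     + Lam \<bullet> (sMat y - (1 / 2) *\<^sub>R (Mat x ** transpose (Mat x)))"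

lemma Lagrangian_eq_slack:
  "Lagrangian A W Ebar Hu Ubar Hl Lbar x y Lu Ll Lam =
     f3 A W Ebar x y - slack_inner A Hu Ubar Hl Lbar x y Lu Ll Lam"
  by (simp add: Lagrangian_def slack_inner_def inner_diff_right)

lemma primal_feasible_iff:
  "primal_feasible A Hu Ubar Hl Lbar x y \<longleftrightarrow> 0 \<le> Ubar - Hu * KK (YY A x y) \<and>
     0 \<le> Hl * KK (YY A x y) - Lbar \<and> psd (sMat y - (1 / 2) *\<^sub>R (Mat x ** transpose (Mat x)))"
  by (auto simp: primal_feasible_def loewner_le_def less_eq_vec_def)

lemma slack_inner_nonneg:
  assumes "primal_feasible A Hu Ubar Hl Lbar x y" "0 \<le> Lu" "0 \<le> Ll" "psd Lam"
  shows "0 \<le> slack_inner A Hu Ubar Hl Lbar x y Lu Ll Lam"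
  using assms by (simp add: slack_inner_def primal_feasible_iff inner_nonneg_mat psd_inner_nonneg)

text \<open>For fixed multipliers with \<open>Lam\<close> semidefinite the Lagrangian is convex, so
  a stationary point is a global minimizer.\<close>

lemma Lagrangian_le_dual_feasible:
  assumes "dual_feasible A W Ebar Hu Ubar Hl Lbar x y Lu Ll Lam"
  shows "Lagrangian A W Ebar Hu Ubar Hl Lbar x y Lu Ll Lam \<le> Lagrangian A W Ebar Hu Ubar Hl Lbar x' y' Lu Ll Lam"
proof -
  have psd: "psd Lam" using assms by (simp add: dual_feasible_iff)
  then have "sym_mat Lam" by (simp add: psd_def)
  moreover have "quad_grad (KKxy A W) Ebar (Lag_hess Lam) (Lag_lin A Hu Hl Lu Ll Lam) (x, y) = 0"
    using assms by (simp add: dual_feasible_iff)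
  then have "quad (KKxy A W) Ebar (Lag_hess Lam) (Lag_lin A Hu Hl Lu Ll Lam) k (x, y)
      \<le> quad (KKxy A W) Ebar (Lag_hess Lam) (Lag_lin A Hu Hl Lu Ll Lam) k (x', y')" for k
    by (rule convex_quadratic.quad_le_of_grad_eq_0[OF convex_quadratic_Lagrangian[OF psd]])
  ultimately show ?thesis by (simp add: Lagrangian_eq_quad)
qed

text \<open>Zero slack makes the Lagrangian equal to the objective, so both problems attain the weak
  duality bound.\<close>

lemma snl_optimal_if_slack_0:
  assumes pf: "primal_feasible A Hu Ubar Hl Lbar x y"
    and df: "dual_feasible A W Ebar Hu Ubar Hl Lbar x y Lu Ll Lam"
    and s: "slack_inner A Hu Ubar Hl Lbar x y Lu Ll Lam = 0"
  shows "snl_optimal A W Ebar Hu Ubar Hl Lbar x y Lu Ll Lam"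
proof -
  \<comment> \<open>Moving to the primal feasible point cannot lower the Lagrangian, and there it is
    the objective minus a nonnegative slack.\<close>
  have weak: "Lagrangian A W Ebar Hu Ubar Hl Lbar x' y' Lu' Ll' Lam' \<le> f3 A W Ebar x'' y''"
    if "dual_feasible A W Ebar Hu Ubar Hl Lbar x' y' Lu' Ll' Lam'" "primal_feasible A Hu Ubar Hl Lbar x'' y''"
    for x' y' x'' y'' Lu' Ll' Lam'
    using Lagrangian_le_dual_feasible[OF that(1), of x'' y''] slack_inner_nonneg[OF that(2), of Lu' Ll' Lam'] that(1)
    by (simp add: dual_feasible_iff Lagrangian_eq_slack[of A W Ebar Hu Ubar Hl Lbar x''])
  have L: "Lagrangian A W Ebar Hu Ubar Hl Lbar x y Lu Ll Lam = f3 A W Ebar x y"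
    by (simp add: Lagrangian_eq_slack s)
  show ?thesis
    using weak[OF df] weak[OF _ pf] pf df
    by (simp add: snl_optimal_def solves_primal_def solves_dual_def L)
qed

text \<open>Comparison with the damped dual point bounds the slack by a multiple of
  \<open>t\<close>; then \<open>t\<close> tends to 0.\<close>

lemma slack_0_if_solves_dual:
  assumes pf: "primal_feasible A Hu Ubar Hl Lbar x y"
    and sd: "solves_dual A W Ebar Hu Ubar Hl Lbar x y Lu Ll Lam"
  shows "slack_inner A Hu Ubar Hl Lbar x y Lu Ll Lam = 0"
proof -
  define \<delta> where "\<delta> = slack_inner A Hu Ubar Hl Lbar x y Lu Ll Lam"
  define R where "R = (norm (KKxy A W (x, y) - Ebar))\<^sup>2"
  have df: "dual_feasible A W Ebar Hu Ubar Hl Lbar x y Lu Ll Lam" using sd by (simp add: solves_dual_def)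
  then have psd: "psd Lam" and Lu: "sym_mat Lu" "0 \<le> Lu" and Ll: "sym_mat Ll" "0 \<le> Ll"
    and grad: "quad_grad (KKxy A W) Ebar (Lag_hess Lam) (Lag_lin A Hu Hl Lu Ll Lam) (x, y) = 0"
    by (auto simp: dual_feasible_iff)
  interpret convex_quadratic "KKxy A W" "Lag_hess Lam" by (rule convex_quadratic_Lagrangian[OF psd])
  have bound: "\<delta> \<le> (1 / 2) * t * R" if t: "0 < t" "t < 1" for t
  proof -
    define c where "c = 1 - t"
    have c: "0 \<le> c" using t by (simp add: c_def)
    have psd_c: "psd (c *\<^sub>R Lam)" using psd c by (rule psd_scaleR)
    \<comment> \<open>Hessian and linear part depend linearly on the multipliers, so the damped
      quadratic is the Lagrangian of the scaled multipliers.\<close>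
    have hess: "(\<lambda>v. c *\<^sub>R Lag_hess Lam v) = Lag_hess (c *\<^sub>R Lam)"
      by (simp add: fun_eq_iff Lag_hess_def mvec_def matrix_matrix_mult_def vec_eq_iff sum_distrib_left ac_simps)
    have lin: "c *\<^sub>R Lag_lin A Hu Hl Lu Ll Lam = Lag_lin A Hu Hl (c *\<^sub>R Lu) (c *\<^sub>R Ll) (c *\<^sub>R Lam)"
      by (simp add: Lag_lin_def linear_scale[OF linear_svec] linear_scale[OF adjoint_linear[OF linear_KKx]]
          linear_scale[OF adjoint_linear[OF linear_KKy]] scaleR_diff_right)
    obtain d where
      d: "quad_grad (KKxy A W) Ebar (\<lambda>v. c *\<^sub>R Lag_hess Lam v) (c *\<^sub>R Lag_lin A Hu Hl Lu Ll Lam) ((x, y) + d) = 0"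
        "quad (KKxy A W) Ebar (\<lambda>v. c *\<^sub>R Lag_hess Lam v) (c *\<^sub>R Lag_lin A Hu Hl Lu Ll Lam)
           (c * (Ll \<bullet> Lbar - Lu \<bullet> Ubar)) (x, y) - (1 / 2) * t\<^sup>2 * R
         \<le> quad (KKxy A W) Ebar (\<lambda>v. c *\<^sub>R Lag_hess Lam v) (c *\<^sub>R Lag_lin A Hu Hl Lu Ll Lam)
           (c * (Ll \<bullet> Lbar - Lu \<bullet> Ubar)) ((x, y) + d)"
      using damped_minimizer[OF grad t(2), of "Ll \<bullet> Lbar - Lu \<bullet> Ubar"] unfolding R_def c_def by blast
    define x' where "x' = x + fst d"
    define y' where "y' = y + snd d"
    have z': "(x, y) + d = (x', y')" by (simp add: x'_def y'_def prod_eq_iff)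
    have k: "c * (Ll \<bullet> Lbar - Lu \<bullet> Ubar) = (c *\<^sub>R Ll) \<bullet> Lbar - (c *\<^sub>R Lu) \<bullet> Ubar"
      by (simp add: right_diff_distrib)
    note sym_c = psd_c[unfolded psd_def, THEN conjunct1]
    have df': "dual_feasible A W Ebar Hu Ubar Hl Lbar x' y' (c *\<^sub>R Lu) (c *\<^sub>R Ll) (c *\<^sub>R Lam)"
      using d(1) psd_c Lu Ll c
      by (simp add: dual_feasible_iff hess lin z' sym_mat_iff less_eq_vec_def)
    have "Lagrangian A W Ebar Hu Ubar Hl Lbar x y (c *\<^sub>R Lu) (c *\<^sub>R Ll) (c *\<^sub>R Lam) - (1 / 2) * t\<^sup>2 * R
       \<le> Lagrangian A W Ebar Hu Ubar Hl Lbar x' y' (c *\<^sub>R Lu) (c *\<^sub>R Ll) (c *\<^sub>R Lam)"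
      using d(2) unfolding hess lin z' k Lagrangian_eq_quad[OF sym_c] .
    also have "\<dots> \<le> Lagrangian A W Ebar Hu Ubar Hl Lbar x y Lu Ll Lam"
      using sd df' by (simp add: solves_dual_def)
    \<comment> \<open>The objective value at \<open>(x, y)\<close> cancels, and scaling the
      multipliers by \<open>c\<close> scales the slack by \<open>c\<close>.\<close>
    finally have "\<delta> \<le> c * \<delta> + (1 / 2) * t\<^sup>2 * R"
      by (simp add: Lagrangian_eq_slack \<delta>_def slack_inner_def distrib_left)
    then have "t * \<delta> \<le> t * ((1 / 2) * t * R)" by (simp add: c_def algebra_simps power2_eq_square)
    then show ?thesis using t by simp
  qed
  have "((\<lambda>t. (1 / 2) * t * R) \<longlongrightarrow> (1 / 2) * 0 * R) (at_right 0)" by (intro tendsto_intros)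
  moreover have "eventually (\<lambda>t. \<delta> \<le> (1 / 2) * t * R) (at_right 0)"
    unfolding eventually_at_right_field by (intro exI[of _ 1]) (use bound in auto)
  ultimately have "\<delta> \<le> (1 / 2) * 0 * R" by (rule tendsto_lowerbound) simp
  moreover have "0 \<le> \<delta>" unfolding \<delta>_def using slack_inner_nonneg[OF pf Lu(2) Ll(2) psd] .
  ultimately show ?thesis by (simp add: \<delta>_def)
qed

lemma snl_optimal_iff:
  "snl_optimal A W Ebar Hu Ubar Hl Lbar x y Lu Ll Lam \<longleftrightarrow>
     primal_feasible A Hu Ubar Hl Lbar x y \<and>
     dual_feasible A W Ebar Hu Ubar Hl Lbar x y Lu Ll Lam \<and>
     slack_inner A Hu Ubar Hl Lbar x y Lu Ll Lam = 0"
  using snl_optimal_if_slack_0 slack_0_if_solves_dual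
  by (metis snl_optimal_def solves_primal_def solves_dual_def)

section \<open>Symmetry of the matrices in the constraints\<close>

lemma sym_mat_hadamard: "sym_mat H \<Longrightarrow> sym_mat B \<Longrightarrow> sym_mat (H * B)"
  by (simp add: sym_mat_iff)

lemma sym_mat_diff: "sym_mat B \<Longrightarrow> sym_mat D \<Longrightarrow> sym_mat (B - D)"
  by (simp add: sym_mat_iff)

lemma sym_mat_KK: "sym_mat B \<Longrightarrow> sym_mat (KK B)"
  by (simp add: sym_mat_iff KK_def)

lemma sym_mat_blockmat: "sym_mat P \<Longrightarrow> sym_mat S \<Longrightarrow> R = transpose Q \<Longrightarrow> sym_mat (blockmat P Q R S)"
  by (auto simp: sym_mat_iff blockmat_def transpose_def split: sum.splits)

lemma sym_mat_YY: "sym_mat (YY A x y)"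
proof -
  have "sym_mat (blockmat 0 (Mat x ** transpose A) (A ** transpose (Mat x)) 0)"
    by (rule sym_mat_blockmat) (simp_all add: matrix_transpose_mul, simp_all add: sym_mat_iff)
  moreover have "sym_mat (YYy y)"
    unfolding YYy_def
    by (rule sym_mat_blockmat[OF sym_mat_sMat]) (simp_all add: sym_mat_iff transpose_def vec_eq_iff)
  ultimately show ?thesis by (simp add: YY_def YYx_def sym_mat_iff)
qed

lemma sym_mat_anchor_gram: "sym_mat (anchor_gram A)"
  unfolding anchor_gram_def
  by (rule sym_mat_blockmat)
     (simp_all add: sym_mat_def matrix_transpose_mul, simp_all add: transpose_def vec_eq_iff)

section \<open>The optimality conditions in \<open>svec\<close> coordinates\<close>

theorem theorem5p1:
  fixes A :: "real ^ 'r ^ ('m::{finite,linorder})"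
    and E W Ub Lb Hu Hl Ebar Ubar Lbar :: "real ^ ('n::{finite,linorder} + 'm::{finite,linorder}) ^ ('n + 'm)"
    and x :: "real ^ ('r \<times> 'n)"
    and y lam :: "real ^ 'n upper"
    and Lam Z :: "real ^ ('n::{finite,linorder}) ^ ('n::{finite,linorder})"
    and Lu Ll :: "real ^ ('n + 'm) ^ ('n + 'm)"
    and lu ll su sl :: "real ^ ('n + 'm) upper"
  assumes data: "snl_data A E W Ub Lb Hu Hl"
    and Ebar: "Ebar = W \<odot> (E - KK (anchor_gram A))"
    and Ubar: "Ubar = Hu \<odot> (Ub - KK (anchor_gram A))"
    and Lbar: "Lbar = Hl \<odot> (Lb - KK (anchor_gram A))"
    and Lam: "Lam = sMat lam"
    and Lu: "sym_mat Lu" and lu: "lu = svec Lu"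
    and Ll: "sym_mat Ll" and ll: "ll = svec Ll"
    and su: "su = svec (Ubar - Hu \<odot> KK (YY A x y))"
    and sl: "sl = svec (Hl \<odot> KK (YY A x y) - Lbar)"
    and Z: "Z = sMat y - (1 / 2) *\<^sub>R (Mat x ** transpose (Mat x))"
  shows "snl_optimal A W Ebar Hu Ubar Hl Lbar x y Lu Ll Lam \<longleftrightarrow>
    \<comment> \<open>primal feasibility\<close>
    (0 \<le> su \<and> 0 \<le> sl \<and> (1 / 2) *\<^sub>R (Mat x ** transpose (Mat x)) - sMat y \<preceq> 0) \<and>
    \<comment> \<open>dual feasibility\<close>
    (adjoint (KKx A W) (W \<odot> KK (YY A x y) - Ebar)
       + adjoint (KKx A Hu) Lu - adjoint (KKx A Hl) Ll + mvec (Lam ** Mat x) = 0 \<and>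
     adjoint (KKy W) (W \<odot> KK (YY A x y) - Ebar)
       + adjoint (KKy Hu) Lu - adjoint (KKy Hl) Ll - svec Lam = 0 \<and>
     0 \<preceq> Lam \<and> 0 \<le> lu \<and> 0 \<le> ll) \<and>
    \<comment> \<open>complementary slackness\<close>
    (lu \<odot> su = 0 \<and> ll \<odot> sl = 0 \<and> Lam ** Z = 0)"
proof -
  interpret snl_data A E W Ub Lb Hu Hl by (rule data)
  let ?Su = "Ubar - Hu * KK (YY A x y)" and ?Sl = "Hl * KK (YY A x y) - Lbar"
  have symS: "sym_mat ?Su" "sym_mat ?Sl"
    unfolding Ubar Lbar
    by (intro sym_mat_diff sym_mat_hadamard sym_mat_KK sym_mat_YY sym_mat_anchor_gram symmetric)+
  have nn: "0 \<le> su \<longleftrightarrow> 0 \<le> ?Su" "0 \<le> sl \<longleftrightarrow> 0 \<le> ?Sl" "0 \<le> lu \<longleftrightarrow> 0 \<le> Lu" "0 \<le> ll \<longleftrightarrow> 0 \<le> Ll"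
    unfolding su sl lu ll by (intro svec_nonneg_iff symS Lu Ll)+
  have inner: "Lu \<bullet> ?Su = lu \<bullet> su" "Ll \<bullet> ?Sl = ll \<bullet> sl"
    using Lu Ll symS by (simp_all add: su sl lu ll svec_isometry)
  have pf: "primal_feasible A Hu Ubar Hl Lbar x y \<longleftrightarrow>
      0 \<le> su \<and> 0 \<le> sl \<and> (1 / 2) *\<^sub>R (Mat x ** transpose (Mat x)) - sMat y \<preceq> 0"
    and pf_Z: "primal_feasible A Hu Ubar Hl Lbar x y \<longleftrightarrow> 0 \<le> su \<and> 0 \<le> sl \<and> psd Z"
    unfolding nn by (auto simp: primal_feasible_iff loewner_le_def Z)
  \<comment> \<open>The two stationarity equations are the components of the joint gradient
    equation.\<close>
  have df: "dual_feasible A W Ebar Hu Ubar Hl Lbar x y Lu Ll Lam \<longleftrightarrow>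
     adjoint (KKx A W) (W \<odot> KK (YY A x y) - Ebar)
       + adjoint (KKx A Hu) Lu - adjoint (KKx A Hl) Ll + mvec (Lam ** Mat x) = 0 \<and>
     adjoint (KKy W) (W \<odot> KK (YY A x y) - Ebar)
       + adjoint (KKy Hu) Lu - adjoint (KKy Hl) Ll - svec Lam = 0 \<and>
     0 \<preceq> Lam \<and> 0 \<le> lu \<and> 0 \<le> ll"
    using Lu Ll unfolding nn hadamard_KK_YY
    by (auto simp: dual_feasible_iff quad_grad_def Lag_hess_def Lag_lin_def adjoint_KKxy loewner_le_def
        zero_prod_def algebra_simps)
  have df_nn: "psd Lam \<and> 0 \<le> lu \<and> 0 \<le> ll"
    if "dual_feasible A W Ebar Hu Ubar Hl Lbar x y Lu Ll Lam"
    using that unfolding nn by (simp add: dual_feasible_iff)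
  \<comment> \<open>Feasibility makes all three summands of the slack nonnegative, so a zero sum
    separates into three equations.\<close>
  have cs: "slack_inner A Hu Ubar Hl Lbar x y Lu Ll Lam = 0 \<longleftrightarrow> lu \<odot> su = 0 \<and> ll \<odot> sl = 0 \<and> Lam ** Z = 0"
    if "primal_feasible A Hu Ubar Hl Lbar x y" "dual_feasible A W Ebar Hu Ubar Hl Lbar x y Lu Ll Lam"
  proof -
    have pos: "0 \<le> su" "0 \<le> sl" "psd Z" "psd Lam" "0 \<le> lu" "0 \<le> ll"
      using that(1) df_nn[OF that(2)] by (simp_all add: pf_Z)
    have "slack_inner A Hu Ubar Hl Lbar x y Lu Ll Lam = lu \<bullet> su + ll \<bullet> sl + Lam \<bullet> Z"
      by (simp add: slack_inner_def inner Z)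
    also have "\<dots> = 0 \<longleftrightarrow> lu \<bullet> su = 0 \<and> ll \<bullet> sl = 0 \<and> Lam \<bullet> Z = 0"
      using inner_nonneg_vec[of lu su] inner_nonneg_vec[of ll sl] psd_inner_nonneg[of Lam Z] pos
      by (auto simp: add_nonneg_eq_0_iff)
    \<comment> \<open>For nonnegative vectors, and for semidefinite matrices, orthogonality is the
      same as a vanishing product.\<close>
    also have "\<dots> \<longleftrightarrow> lu \<odot> su = 0 \<and> ll \<odot> sl = 0 \<and> Lam ** Z = 0"
      using pos by (simp only: inner_eq_0_iff_times psd_inner_eq_0_iff)
    finally show ?thesis .
  qed
  show ?thesis
    unfolding snl_optimal_iff pf[symmetric] df[symmetric] using cs by blast
qed

end
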